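(* Under the standing assumptions in the context, let $\beta\in(0,1)$ and let the sequence $(x_k)_{k\ge0}$ be generated by PSGA (from $x_0\in\mathcal{T}_\beta$) with step-sizes satisfying $\lim_{k\to\infty}\alpha_k=0$, $\sum_{k}\alpha_k=\infty$, and $$0<\alpha_k\le\min\{1,2(1-\beta)\tau\}\Big(\frac{\beta\mu}{\rho G_h}\Big)^{1/\nu}\quad\text{for all }k.$$ Let $f_k^*:=\min\{f(x_i):i=0,1,\dots,k\}$. Then: (a) $\lim_{k\to\infty}f_k^*=\liminf_{k\to\infty}f(x_k)=f^*$; (b) $\liminf_{k\to\infty}\operatorname{dist}(x_k;\mathcal{X}^* )=0$; (c) if $(x_k)$ is bounded, it has a subsequence converging to some optimal solution (a point of $\mathcal{X}^*$).
   Context: Notation: $\|\cdot\|$ is the Euclidean norm on $\mathbb{R}^n$, $\operatorname{dist}(x;S)=\inf_{z\in S}\|z-x\|$, $\operatorname{proj}_S(x)=\operatorname{argmin}_{z\in S}\|z-x\|$ (a set in general). $\partial f(x)$ is the Fréchet subdifferential: all $\zeta$ with $f(y)\ge f(x)+\langle\zeta,y-x\rangle+o(\|y-x\|)$ as $y\to x$. Standing assumptions: $h:\mathbb{R}^n\to\mathbb{R}\cup\{+\infty\}$ is a Legendre kernel: proper, lower semicontinuous, strictly convex, continuously differentiable on $\operatorname{int}\operatorname{dom}(h)\ne\emptyset$, and essentially smooth ($\|\nabla h(x_k)\|\to\infty$ whenever $x_k\in\operatorname{int}\operatorname{dom}(h)$ converges to a boundary point of $\operatorname{dom}(h)$). $D_h(x,y)=h(x)-h(y)-\langle\nabla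 h(y),x-y\rangle$ for $y\in\operatorname{int}\operatorname{dom}(h)$. $X\subseteq\operatorname{int}\operatorname{dom}(h)$ is nonempty, closed and convex. $f:\mathbb{R}^n\to\mathbb{R}\cup\{+\infty\}$ is proper (not assumed differentiable), $\rho>0$, and $f+\rho h$ is convex on $\operatorname{int}\operatorname{dom}(h)$ ($f$ is $\rho$-weakly convex relative to $h$); $f$ is finite and locally Lipschitz around every point of $X$. $f^*:=\inf_Xf>-\infty$ and $\mathcal{X}^*:=\{x\in X:f(x)=f^*\}\neq\emptyset$. Sharpness: $\mu>0$ and $\mu\operatorname{dist}(x;\mathcal{X}^* )\le f(x)-f^*$ for all $x\in X$. Local Bregman growth: $\nu\in(0,1]$, $G_h>0$ and $\inf_{y\in\operatorname{proj}_{\mathcal{X}^*}(x)}D_h(y,x)\le G_h\operatorname{dist}^{1+\nu}(x;\mathcal{X}^* )$ for all $x\in X$ with $\operatorname{dist}(x;\mathcal{X}^* )<(\mu/(\rho G_h))^{1/\nu}$. For $\beta\in(0,1]$, $\mathcal{T}_\beta:=\{x\in X:\operatorname{dist}(x;\mathcal{X}^* )<(\beta\mu/(\rho G_h))^{1/\nu}\}$. $L:=\sup\{\|\zeta\|:\zeta\in\partial f(x),\,x\in\mathcal{T}_1\}$, assumed to satisfy $0<L<\infty$, and $\tau:=\mu/L$. PSGA (projected subgradient algorithm): given $\beta\in(0,1)$, $x_0\in\mathcal{T}_\beta$ and step-sizes $\alpha_k>0$, for $k=0,1,2,\dots$ choose any $\zeta_k\in\partial f(x_k)$ and set $x_{k+1}=\operatorname{proj}_X\big(x_k-\alpha_k\zeta_k/\|\zeta_k\|\big)$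 (with $x_{k+1}=x_k$ if $\zeta_k=0$). *)

theory Defs
  imports "HOL-Analysis.Analysis" "HOL-Library.Landau_Symbols"
begin

text \<open>
  Functions with values in the reals extended by \<open>+\<infinity>\<close> are modelled as \<open>ereal\<close>-valued functions
  that never take the value \<open>-\<infinity>\<close>; the latter is part of \<open>proper_fun\<close>.
\<close>

definition eff_dom :: "('a \<Rightarrow> ereal) \<Rightarrow> 'a set" where
  "eff_dom h = {x. h x < \<infinity>}"

definition proper_fun :: "('a \<Rightarrow> ereal) \<Rightarrow> bool" where
  "proper_fun h \<longleftrightarrow> (\<forall>x. h x \<noteq> -\<infinity>) \<and> (\<exists>x. h x < \<infinity>)"

definition lower_semicont :: "('a::topological_space \<Rightarrow> ereal) \<Rightarrow> bool" where
  "lower_semicont h \<longleftrightarrow> (\<forall>x. h x \<le> Liminf (at x) h)"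

definition ereal_convex_on :: "'a::real_vector set \<Rightarrow> ('a \<Rightarrow> ereal) \<Rightarrow> bool" where
  "ereal_convex_on S F \<longleftrightarrow> convex S \<and>
     (\<forall>x\<in>S. \<forall>y\<in>S. \<forall>t. 0 < t \<and> t < 1 \<longrightarrow>
        F ((1 - t) *\<^sub>R x + t *\<^sub>R y) \<le> ereal (1 - t) * F x + ereal t * F y)"

definition strictly_convex_fun :: "('a::real_vector \<Rightarrow> ereal) \<Rightarrow> bool" where
  "strictly_convex_fun h \<longleftrightarrow>
     (\<forall>x\<in>eff_dom h. \<forall>y\<in>eff_dom h. \<forall>t. x \<noteq> y \<and> 0 < t \<and> t < 1 \<longrightarrow>
        h ((1 - t) *\<^sub>R x + t *\<^sub>R y) < ereal (1 - t) * h x + ereal t * h y)"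

text \<open>The gradient is meaningful only where the function is finite near the point and differentiable.\<close>

definition grad :: "('a::real_inner \<Rightarrow> ereal) \<Rightarrow> 'a \<Rightarrow> 'a" where
  "grad h x = (THE g. GDERIV (\<lambda>y. real_of_ereal (h y)) x :> g)"

definition cont_diff_on :: "'a::real_inner set \<Rightarrow> ('a \<Rightarrow> ereal) \<Rightarrow> bool" where
  "cont_diff_on S h \<longleftrightarrow>
     (\<forall>x\<in>S. \<exists>g. GDERIV (\<lambda>y. real_of_ereal (h y)) x :> g) \<and> continuous_on S (grad h)"

definition essentially_smooth :: "('a::real_inner \<Rightarrow> ereal) \<Rightarrow> bool" where
  "essentially_smooth h \<longleftrightarrow>
     (\<forall>u z. (\<forall>k::nat. u k \<in> interior (eff_dom h)) \<and> z \<in> frontier (eff_dom h) \<and> u \<longlonglongrightarrow> z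
        \<longrightarrow> filterlim (\<lambda>k. norm (grad h (u k))) at_top sequentially)"

definition legendre_kernel :: "('a::real_inner \<Rightarrow> ereal) \<Rightarrow> bool" where
  "legendre_kernel h \<longleftrightarrow>
     proper_fun h \<and> lower_semicont h \<and> strictly_convex_fun h \<and>
     interior (eff_dom h) \<noteq> {} \<and> cont_diff_on (interior (eff_dom h)) h \<and>
     essentially_smooth h"

definition bregman :: "('a::real_inner \<Rightarrow> ereal) \<Rightarrow> 'a \<Rightarrow> 'a \<Rightarrow> ereal" where
  "bregman h x y = h x - h y - ereal (grad h y \<bullet> (x - y))"

definition proj_set :: "'a::real_normed_vector set \<Rightarrow> 'a \<Rightarrow> 'a set" where
  "proj_set S x = {z. is_arg_min (\<lambda>z. norm (z - x)) (\<lambda>z. z \<in> S) z}"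

text \<open>The Frechet subdifferential, empty at points where the function is not finite.\<close>

definition frechet_subdiff :: "('a::real_inner \<Rightarrow> ereal) \<Rightarrow> 'a \<Rightarrow> 'a set" where
  "frechet_subdiff f x = {\<zeta>. \<bar>f x\<bar> \<noteq> \<infinity> \<and>
     (\<exists>r::'a \<Rightarrow> real. r \<in> o[at x](\<lambda>y. norm (y - x)) \<and>
        (\<forall>\<^sub>F y in at x. f x + ereal (\<zeta> \<bullet> (y - x) + r y) \<le> f y))}"

definition finite_locally_lipschitz_around :: "'a::metric_space set \<Rightarrow> ('a \<Rightarrow> ereal) \<Rightarrow> bool" where
  "finite_locally_lipschitz_around X f \<longleftrightarrow>
     (\<forall>x\<in>X. \<exists>e>0. \<exists>C. (\<forall>y\<in>ball x e. \<bar>f y\<bar> \<noteq> \<infinity>) \<and>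
        C-lipschitz_on (ball x e) (\<lambda>y. real_of_ereal (f y)))"

definition opt_val :: "('a \<Rightarrow> ereal) \<Rightarrow> 'a set \<Rightarrow> ereal" where
  "opt_val f X = (INF x\<in>X. f x)"

definition opt_set :: "('a \<Rightarrow> ereal) \<Rightarrow> 'a set \<Rightarrow> 'a set" where
  "opt_set f X = {x\<in>X. f x = opt_val f X}"

text \<open>
  \<open>infdist\<close> is the distance to a set; it agrees with the usual infimum for nonempty sets.
\<close>

definition tube :: "('a::metric_space \<Rightarrow> ereal) \<Rightarrow> 'a set \<Rightarrow> real \<Rightarrow> real \<Rightarrow> real \<Rightarrow> real \<Rightarrow> real \<Rightarrow> 'a set"
  where
  "tube f X \<mu> \<rho> G \<nu> \<beta> =
     {x\<in>X. infdist x (opt_set f X) < (\<beta> * \<mu> / (\<rho> * G)) powr (1 / \<nu>)}"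

definition sharp :: "('a::metric_space \<Rightarrow> ereal) \<Rightarrow> 'a set \<Rightarrow> real \<Rightarrow> bool" where
  "sharp f X \<mu> \<longleftrightarrow> (\<forall>x\<in>X. ereal (\<mu> * infdist x (opt_set f X)) \<le> f x - opt_val f X)"

definition local_bregman_growth ::
  "('a::real_inner \<Rightarrow> ereal) \<Rightarrow> ('a \<Rightarrow> ereal) \<Rightarrow> 'a set \<Rightarrow> real \<Rightarrow> real \<Rightarrow> real \<Rightarrow> real \<Rightarrow> bool" where
  "local_bregman_growth h f X \<mu> \<rho> G \<nu> \<longleftrightarrow>
     (\<forall>x\<in>X. infdist x (opt_set f X) < (\<mu> / (\<rho> * G)) powr (1 / \<nu>) \<longrightarrow>
        (INF y\<in>proj_set (opt_set f X) x. bregman h y x)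
          \<le> ereal (G * infdist x (opt_set f X) powr (1 + \<nu>)))"

text \<open>
  Runs of the projected subgradient algorithm with step sizes \<open>\<alpha>\<close>, iterates \<open>x\<close> and chosen
  subgradients \<open>\<zeta>\<close>. For nonempty closed convex \<open>X\<close> the projection is a singleton, so
  membership determines the next iterate.
\<close>

definition psga_run ::
  "('a::real_inner \<Rightarrow> ereal) \<Rightarrow> 'a set \<Rightarrow> (nat \<Rightarrow> real) \<Rightarrow> (nat \<Rightarrow> 'a) \<Rightarrow> (nat \<Rightarrow> 'a) \<Rightarrow> bool" where
  "psga_run f X \<alpha> x \<zeta> \<longleftrightarrow>
     (\<forall>k. \<zeta> k \<in> frechet_subdiff f (x k) \<and>
        (if \<zeta> k = 0 then x (Suc k) = x k
         else x (Suc k) \<in> proj_set X (x k - (\<alpha> k / norm (\<zeta> k)) *\<^sub>R \<zeta> k)))"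

end

theory Submission
  imports Defs
begin

text \<open>
  Let \<open>d k\<close> be the distance of \<open>x k\<close> to the solution set and let \<open>R\<close> be the radius of the tube with
  parameter \<open>\<beta>\<close>. Testing relative weak convexity at a nearest solution \<open>y\<close> bounds
  \<open>\<zeta> k \<bullet> (x k - y)\<close> below by \<open>f (x k) - f\<^sup>* - \<rho> * D\<^sub>h y (x k)\<close>, and as long as \<open>d k \<le> R\<close>, growth
  and sharpness absorb the Bregman term into \<open>\<beta> * (f (x k) - f\<^sup>*)\<close>. Nonexpansiveness of the
  projection then gives
  \<open>(d (k+1))\<^sup>2 \<le> (d k)\<^sup>2 - 2 * (1 - \<beta>) / L * \<alpha> k * (f (x k) - f\<^sup>*) + (\<alpha> k)\<^sup>2\<close>. The step size
  bound keeps \<open>d k \<le> R\<close>, and divergence of the step size series forces \<open>f (x k) - f\<^sup>*\<close> to be small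
  infinitely often.

  The invariant is the closed tube \<open>d k \<le> R\<close>: an iterate may leave the open one, since a full step
  of length \<open>R\<close> can be taken from a solution.
\<close>

section \<open>Gradients, Frechet subgradients and relative weak convexity\<close>

lemma gderiv_grad:
  assumes "GDERIV (\<lambda>y. real_of_ereal (h y)) x :> g"
  shows "grad h x = g"
  unfolding grad_def
proof (rule the_equality)
  fix g' assume "GDERIV (\<lambda>y. real_of_ereal (h y)) x :> g'"
  then have "(\<lambda>v. v \<bullet> g') = (\<lambda>v. v \<bullet> g)"
    using assms has_derivative_unique unfolding gderiv_def by blast
  then have "(g' - g) \<bullet> g' = (g' - g) \<bullet> g"
    by meson
  then have "(g' - g) \<bullet> (g' - g) = 0"
    by (simp add: inner_diff_right)
  then show "g' = g" by simp
qed (fact assms)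

text \<open>This lets the kernel be treated like \<open>f\<close>: both enter the convexity argument
  only through first-order lower bounds. The Taylor remainder of \<open>h\<close> at
  \<open>x\<close> serves as the little-o term, so the bound holds with equality near
  \<open>x\<close>.\<close>

lemma grad_in_frechet_subdiff:
  fixes h :: "'a::real_inner \<Rightarrow> ereal"
  assumes "proper_fun h" "x \<in> interior (eff_dom h)"
    and "GDERIV (\<lambda>y. real_of_ereal (h y)) x :> g"
  shows "g \<in> frechet_subdiff h x"
proof -
  let ?r = "\<lambda>y. real_of_ereal (h y) - real_of_ereal (h x) - (y - x) \<bullet> g"
  have fin: "\<bar>h y\<bar> \<noteq> \<infinity>" if "y \<in> interior (eff_dom h)" for y
    using that assms(1) interior_subset[of "eff_dom h"] by (auto simp: eff_dom_def proper_fun_def)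
  have "((\<lambda>y. norm (?r y) / norm (y - x)) \<longlongrightarrow> 0) (at x)"
    using assms(3) unfolding gderiv_def has_derivative_iff_norm by simp
  then have "((\<lambda>y. norm (?r y / norm (y - x))) \<longlongrightarrow> 0) (at x)"
    by (simp add: abs_divide)
  then have "((\<lambda>y. ?r y / norm (y - x)) \<longlongrightarrow> 0) (at x)"
    by (rule tendsto_norm_zero_cancel)
  then have "?r \<in> o[at x](\<lambda>y. norm (y - x))"
    by (rule smalloI_tendsto) (auto simp: eventually_at_filter)
  moreover have "\<forall>\<^sub>F y in at x. h x + ereal (g \<bullet> (y - x) + ?r y) \<le> h y"
  proof -
    have "\<forall>\<^sub>F y in at x. y \<in> interior (eff_dom h)"
      using assms(2) by (intro eventually_at_in_open') auto
    then show ?thesis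
    proof eventually_elim
      case (elim y)
      then show ?case
        using fin[OF elim] fin[OF assms(2)]
        by (cases "h y"; cases "h x") (auto simp: inner_commute)
    qed
  qed
  ultimately show ?thesis
    using fin[OF assms(2)] unfolding frechet_subdiff_def by blast
qed

text \<open>Along a fixed ray the displacement has length \<open>t * norm v\<close>, so the little-o
  remainder is eventually at most \<open>t * c\<close> for any prescribed
  \<open>c > 0\<close>.\<close>

lemma frechet_subdiff_direction:
  fixes f :: "'a::real_inner \<Rightarrow> ereal"
  assumes "\<zeta> \<in> frechet_subdiff f x" "c > 0"
  shows "\<forall>\<^sub>F t in at_right 0. ereal (real_of_ereal (f x) + t * (\<zeta> \<bullet> v - c)) \<le> f (x + t *\<^sub>R v)"
proof -
  obtain r where fin: "\<bar>f x\<bar> \<noteq> \<infinity>" and r: "r \<in> o[at x](\<lambda>y. norm (y - x))"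
    and low: "\<forall>\<^sub>F y in at x. f x + ereal (\<zeta> \<bullet> (y - x) + r y) \<le> f y"
    using assms(1) unfolding frechet_subdiff_def by auto
  obtain a where a: "f x = ereal a" using fin by auto
  have pos: "\<forall>\<^sub>F t in at_right 0. (t::real) > 0"
    by (simp add: eventually_at_right_less)
  show ?thesis
  \<comment> \<open>The filter \<open>at x\<close> excludes \<open>x\<close> itself, so the constant
    ray cannot be pushed through it; there the claim is just
    \<open>f x - t * c \<le> f x\<close>.\<close>
  proof (cases "v = 0")
    case True
    show ?thesis using pos by eventually_elim (use assms(2) True a in auto)
  next
    case False
    have "((\<lambda>t. x + t *\<^sub>R v) \<longlongrightarrow> x + 0 *\<^sub>R v) (at_right 0)"
      by (intro tendsto_intros)
    moreover have "\<forall>\<^sub>F t in at_right 0. x + t *\<^sub>R v \<noteq> x"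
      using pos by eventually_elim (use False in auto)
    ultimately have "filterlim (\<lambda>t. x + t *\<^sub>R v) (at x) (at_right 0)"
      by (simp add: filterlim_at)
    moreover have "\<forall>\<^sub>F y in at x. norm (r y) \<le> (c / norm v) * norm (norm (y - x))"
      using False assms(2) by (intro landau_o.smallD[OF r]) simp
    ultimately have
      "\<forall>\<^sub>F t in at_right 0. norm (r (x + t *\<^sub>R v)) \<le> (c / norm v) * norm (norm (x + t *\<^sub>R v - x))"
      "\<forall>\<^sub>F t in at_right 0. f x + ereal (\<zeta> \<bullet> (x + t *\<^sub>R v - x) + r (x + t *\<^sub>R v)) \<le> f (x + t *\<^sub>R v)"
      using low unfolding filterlim_iff by blast+
    then show ?thesis
      using pos
    proof eventually_elim
      case (elim t)
      then have "\<bar>r (x + t *\<^sub>R v)\<bar> \<le> t * c" using False by (simp add: field_simps)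
      then have "real_of_ereal (f x) + t * (\<zeta> \<bullet> v - c) \<le> a + (t * (\<zeta> \<bullet> v) + r (x + t *\<^sub>R v))"
        using a by (simp add: algebra_simps abs_le_iff)
      then show ?case using elim(2) a by (auto intro: order_trans[rotated])
    qed
  qed
qed

text \<open>At a point of the segment close to \<open>x\<close>, convexity bounds
  \<open>f + \<rho> h\<close> from above by the endpoint values, while the two subgradients bound it
  from below. Comparing both bounds and dividing by \<open>t\<close> leaves the first-order
  inequality up to \<open>e\<close>.\<close>

lemma relative_weak_convexity_subgradient:
  fixes f h :: "'a::real_inner \<Rightarrow> ereal"
  assumes conv: "ereal_convex_on C (\<lambda>z. f z + ereal \<rho> * h z)" and "\<rho> > 0"
    and "x \<in> C" "y \<in> C"
    and \<zeta>: "\<zeta> \<in> frechet_subdiff f x" and g: "g \<in> frechet_subdiff h x"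
    and fy: "f y = ereal b" and hy: "h y = ereal q" and fx: "f x = ereal a" and hx: "h x = ereal p"
  shows "a + \<zeta> \<bullet> (y - x) \<le> b + \<rho> * (q - p - g \<bullet> (y - x))"
proof (rule field_le_epsilon)
  fix e :: real assume "e > 0"
  \<comment> \<open>The slack \<open>c\<close> is lost once for \<open>f\<close> and
    \<open>\<rho>\<close> times for \<open>h\<close>, which adds up to \<open>e\<close>.\<close>
  define c where "c = e / (1 + \<rho>)"
  have "c > 0" using \<open>e > 0\<close> \<open>\<rho> > 0\<close> by (simp add: c_def)
  moreover have "(1 + \<rho>) * c = e" using \<open>\<rho> > 0\<close> by (simp add: c_def)
  ultimately have c: "c > 0" "c + \<rho> * c = e" by (auto simp: algebra_simps)
  let ?v = "y - x"
  have "\<forall>\<^sub>F t in at_right 0. (t::real) < 1"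
    by (rule eventually_at_right_real[THEN eventually_mono, of 0 1]) auto
  moreover have "\<forall>\<^sub>F t in at_right 0. (t::real) > 0"
    by (simp add: eventually_at_right_less)
  ultimately have "\<forall>\<^sub>F t in at_right 0. 0 < t \<and> t < 1 \<and>
      ereal (a + t * (\<zeta> \<bullet> ?v - c)) \<le> f (x + t *\<^sub>R ?v) \<and>
      ereal (p + t * (g \<bullet> ?v - c)) \<le> h (x + t *\<^sub>R ?v)"
    using frechet_subdiff_direction[OF \<zeta> c(1), of ?v] frechet_subdiff_direction[OF g c(1), of ?v]
    by eventually_elim (simp add: fx hx)
  then obtain t where t: "0 < t" "t < 1"
    and lf: "ereal (a + t * (\<zeta> \<bullet> ?v - c)) \<le> f (x + t *\<^sub>R ?v)"
    and lh: "ereal (p + t * (g \<bullet> ?v - c)) \<le> h (x + t *\<^sub>R ?v)"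
    by (auto dest!: eventually_happens)
  have z: "(1 - t) *\<^sub>R x + t *\<^sub>R y = x + t *\<^sub>R ?v"
    by (simp add: algebra_simps)
  have "f (x + t *\<^sub>R ?v) + ereal \<rho> * h (x + t *\<^sub>R ?v)
      \<le> ereal (1 - t) * (f x + ereal \<rho> * h x) + ereal t * (f y + ereal \<rho> * h y)"
    using conv t assms(3,4) unfolding ereal_convex_on_def z[symmetric] by blast
  also have "\<dots> = ereal ((1 - t) * (a + \<rho> * p) + t * (b + \<rho> * q))"
    by (simp add: fx hx fy hy)
  finally have up: "f (x + t *\<^sub>R ?v) + ereal \<rho> * h (x + t *\<^sub>R ?v) \<le> \<dots>" .
  \<comment> \<open>Chaining inside \<open>ereal\<close> eliminates the values at the intermediate
    point, whose finiteness has not been established for \<open>f\<close>.\<close>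
  have "ereal (a + t * (\<zeta> \<bullet> ?v - c)) + ereal \<rho> * ereal (p + t * (g \<bullet> ?v - c))
      \<le> f (x + t *\<^sub>R ?v) + ereal \<rho> * h (x + t *\<^sub>R ?v)"
    using lf lh \<open>\<rho> > 0\<close> by (intro add_mono ereal_mult_left_mono) auto
  from order_trans[OF this up]
  have "(a + t * (\<zeta> \<bullet> ?v - c)) + \<rho> * (p + t * (g \<bullet> ?v - c))
      \<le> (1 - t) * (a + \<rho> * p) + t * (b + \<rho> * q)"
    by simp
  then have "t * (a + \<zeta> \<bullet> ?v) \<le> t * (b + \<rho> * (q - p - g \<bullet> ?v) + (c + \<rho> * c))"
    by (simp add: algebra_simps)
  then show "a + \<zeta> \<bullet> ?v \<le> b + \<rho> * (q - p - g \<bullet> ?v) + e"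
    using t c by simp
qed

section \<open>One projected step\<close>

text \<open>The angle at the projection \<open>p\<close> between \<open>u\<close> and
  \<open>y\<close> is not acute, so the opposite side, from \<open>u\<close> to \<open>y\<close>, is
  at least as long as the one from \<open>p\<close> to \<open>y\<close>.\<close>

lemma proj_set_step:
  fixes X :: "'a::euclidean_space set"
  assumes "convex X" "closed X" "p \<in> proj_set X u" "y \<in> X"
  shows "dist p y \<le> dist u y"
proof -
  have p: "p \<in> X" "\<forall>z\<in>X. dist u p \<le> dist u z"
    using assms(3) by (auto simp: proj_set_def is_arg_min_linorder dist_norm norm_minus_commute)
  then have "(u - p) \<bullet> (y - p) \<le> 0"
    using any_closest_point_dot assms by blast
  moreover have "(dist u y)\<^sup>2 = (norm (u - p))\<^sup>2 + (dist p y)\<^sup>2 - 2 * ((u - p) \<bullet> (y - p))"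
    by (simp add: dist_norm power2_norm_eq_inner inner_diff_left inner_diff_right inner_commute)
  ultimately have "(dist p y)\<^sup>2 \<le> (dist u y)\<^sup>2"
    using zero_le_power2[of "norm (u - p)"] by linarith
  then show ?thesis by (rule power2_le_imp_le) simp
qed

lemma psga_step_dist:
  fixes X :: "'a::euclidean_space set"
  assumes "convex X" "closed X" "y \<in> X" "\<zeta> \<noteq> 0"
    and "p \<in> proj_set X (x - (\<alpha> / norm \<zeta>) *\<^sub>R \<zeta>)"
  shows "(dist p y)\<^sup>2 \<le> (dist x y)\<^sup>2 - 2 * \<alpha> * (\<zeta> \<bullet> (x - y)) / norm \<zeta> + \<alpha>\<^sup>2"
proof -
  let ?u = "x - (\<alpha> / norm \<zeta>) *\<^sub>R \<zeta>"
  have "(dist p y)\<^sup>2 \<le> (dist ?u y)\<^sup>2"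
    using proj_set_step[OF assms(1,2,5,3)] by (intro power_mono) auto
  also have "\<dots> = (norm ((x - y) - (\<alpha> / norm \<zeta>) *\<^sub>R \<zeta>))\<^sup>2"
    by (simp add: dist_norm algebra_simps)
  also have "\<dots> = (norm (x - y))\<^sup>2 + (norm ((\<alpha> / norm \<zeta>) *\<^sub>R \<zeta>))\<^sup>2
      - 2 * ((x - y) \<bullet> ((\<alpha> / norm \<zeta>) *\<^sub>R \<zeta>))"
    by (simp only: power2_norm_eq_inner inner_diff_left inner_diff_right inner_commute) simp
  also have "\<dots> = (dist x y)\<^sup>2 - 2 * \<alpha> * (\<zeta> \<bullet> (x - y)) / norm \<zeta> + \<alpha>\<^sup>2"
    using assms(4) by (simp add: dist_norm inner_commute)
  finally show ?thesis .
qed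

section \<open>Descent recursions and limits of real sequences\<close>

text \<open>If \<open>g\<close> stayed above \<open>e\<close>, then once the steps are short the
  quadratic term would cancel at most half of the linear decrease. Summing the other half over a
  divergent series would push \<open>a\<close> below zero.\<close>

lemma frequently_small_of_descent:
  fixes a g \<alpha> :: "nat \<Rightarrow> real"
  assumes descent: "\<And>k. a (Suc k) \<le> a k - c * \<alpha> k * g k + (\<alpha> k)\<^sup>2"
    and "c > 0" "\<And>k. 0 < \<alpha> k" "\<And>k. 0 \<le> a k"
    and "\<alpha> \<longlonglongrightarrow> 0" and sums: "filterlim (\<lambda>n. \<Sum>k<n. \<alpha> k) at_top sequentially"
    and "e > 0"
  shows "\<exists>\<^sub>F k in sequentially. g k < e"
proof (rule ccontr)
  assume "\<not> ?thesis"
  then have "\<forall>\<^sub>F k in sequentially. e \<le> g k" by (simp add: not_frequently not_less)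
  \<comment> \<open>Below this threshold \<open>(\<alpha> k)\<^sup>2\<close> is at most half of
    \<open>c * \<alpha> k * e\<close>.\<close>
  moreover have "\<forall>\<^sub>F k in sequentially. \<alpha> k < c * e / 2"
    using assms by (intro order_tendstoD(2)[OF assms(5)]) simp
  ultimately have "\<forall>\<^sub>F k in sequentially. e \<le> g k \<and> \<alpha> k < c * e / 2"
    by eventually_elim simp
  then obtain N where N: "\<And>k. k \<ge> N \<Longrightarrow> e \<le> g k \<and> \<alpha> k < c * e / 2"
    unfolding eventually_sequentially by blast
  define s where "s n = (\<Sum>k<n. \<alpha> k)" for n
  have "a n + c * e / 2 * (s n - s N) \<le> a N" if "n \<ge> N" for n
    using that
  proof (induction n rule: dec_induct)
    case (step n)
    have "c * \<alpha> n * e \<le> c * \<alpha> n * g n"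
      using N[of n] step assms(2) assms(3)[of n] by (intro mult_left_mono) auto
    moreover have "(\<alpha> n)\<^sup>2 \<le> \<alpha> n * (c * e / 2)"
      using N[of n] step assms(3)[of n] unfolding power2_eq_square by (intro mult_left_mono) auto
    ultimately have "a (Suc n) \<le> a n - c * e / 2 * \<alpha> n"
      using descent[of n] by (simp add: algebra_simps)
    moreover have "s (Suc n) - s N = (s n - s N) + \<alpha> n" by (simp add: s_def)
    ultimately show ?case using step.IH by (simp add: right_diff_distrib distrib_left)
  qed simp
  then have bound: "c * e / 2 * (s n - s N) \<le> a N" if "n \<ge> N" for n
    using that assms(4)[of n] by (smt (verit))
  have "\<forall>\<^sub>F n in sequentially. s N + a N / (c * e / 2) < s n"
    using sums unfolding filterlim_at_top_dense s_def by blast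
  moreover have "\<forall>\<^sub>F n in sequentially. n \<ge> N" by (rule eventually_ge_at_top)
  ultimately have "\<forall>\<^sub>F n in sequentially. False"
  proof eventually_elim
    case (elim n)
    then have "a N < c * e / 2 * (s n - s N)" using assms(2,7) by (simp add: field_simps)
    then show False using bound[OF elim(2)] by simp
  qed
  then show False by simp
qed

text \<open>Serves both the objective values and the distances, for which descent yields closeness
  to the lower bound only infinitely often.\<close>

lemma liminf_ereal_eqI:
  fixes u :: "nat \<Rightarrow> real"
  assumes "\<And>k. l \<le> u k" "\<And>e. e > 0 \<Longrightarrow> \<exists>\<^sub>F k in sequentially. u k < l + e"
  shows "liminf (\<lambda>k. ereal (u k)) = ereal l"
proof (rule antisym)
  show "ereal l \<le> liminf (\<lambda>k. ereal (u k))"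
    using assms(1) by (intro Liminf_bounded) simp
  show "liminf (\<lambda>k. ereal (u k)) \<le> ereal l"
  proof (rule ereal_le_epsilon2, rule ccontr)
    fix e :: real assume "0 < e" "\<not> liminf (\<lambda>k. ereal (u k)) \<le> ereal l + ereal e"
    then have "\<forall>\<^sub>F k in sequentially. ereal (l + e) < ereal (u k)"
      by (intro less_LiminfD) simp
    then have "\<forall>\<^sub>F k in sequentially. \<not> u k < l + e" by eventually_elim simp
    then show False using assms(2)[OF \<open>0 < e\<close>] by (simp add: frequently_def)
  qed
qed

text \<open>One index with a value below \<open>b\<close> keeps every later running minimum below
  \<open>b\<close>, so infinitely frequent closeness is enough for a full limit.\<close>

lemma running_Min_tendsto:
  fixes u :: "nat \<Rightarrow> real"
  assumes "\<And>k. l \<le> u k" "\<And>e. e > 0 \<Longrightarrow> \<exists>\<^sub>F k in sequentially. u k < l + e"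
  shows "(\<lambda>k. Min (u ` {..k})) \<longlonglongrightarrow> l"
proof (rule order_tendstoI)
  fix b assume "b < l"
  then have "b < Min (u ` {..k})" for k
    using assms(1) by (auto intro: less_le_trans)
  then show "\<forall>\<^sub>F k in sequentially. b < Min (u ` {..k})" by simp
next
  fix b assume "l < b"
  then obtain j where "u j < b"
    using assms(2)[of "b - l"] frequently_ex by fastforce
  then have "Min (u ` {..k}) < b" if "k \<ge> j" for k
    using that by (subst Min_less_iff) auto
  then show "\<forall>\<^sub>F k in sequentially. Min (u ` {..k}) < b"
    unfolding eventually_sequentially by blast
qed

section \<open>The solution set and the radius of the tube\<close>

text \<open>Local Lipschitz continuity makes the solution set a level set of a continuous function
  on the closed set \<open>X\<close>. Closedness later places a limit at distance zero inside
  it.\<close>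

lemma opt_set_closed:
  assumes "closed X" "finite_locally_lipschitz_around X f"
  shows "closed (opt_set f X)"
proof (cases "opt_set f X = {}")
  case False
  then obtain x0 where x0: "x0 \<in> X" "f x0 = opt_val f X" by (auto simp: opt_set_def)
  have fin: "\<bar>f x\<bar> \<noteq> \<infinity>" if "x \<in> X" for x
    using assms(2) that unfolding finite_locally_lipschitz_around_def
    by (meson centre_in_ball)
  have "continuous_on X (\<lambda>x. real_of_ereal (f x))"
  proof (rule continuous_at_imp_continuous_on, rule ballI)
    fix x assume "x \<in> X"
    then obtain e C where "e > 0" "C-lipschitz_on (ball x e) (\<lambda>y. real_of_ereal (f y))"
      using assms(2) unfolding finite_locally_lipschitz_around_def by blast
    then show "isCont (\<lambda>x. real_of_ereal (f x)) x"
      using lipschitz_on_continuous_on continuous_on_eq_continuous_at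
      by (metis centre_in_ball open_ball)
  qed
  then have "closed (X \<inter> (\<lambda>x. real_of_ereal (f x)) -` {real_of_ereal (opt_val f X)})"
    by (intro continuous_closed_preimage assms) auto
  \<comment> \<open>As \<open>real_of_ereal\<close> sends both infinities to 0, this identity rests
    on the finiteness of \<open>f\<close> on \<open>X\<close>.\<close>
  also have "X \<inter> (\<lambda>x. real_of_ereal (f x)) -` {real_of_ereal (opt_val f X)} = opt_set f X"
    unfolding opt_set_def x0(2)[symmetric] using fin x0(1) by (auto simp: vimage_def) (metis ereal_real')
  finally show ?thesis .
qed simp

text \<open>The right-hand side of the first assumption is a convex function of \<open>d\<close>, and at both \<open>d = 0\<close> and \<open>d = R\<close> it is at
  most \<open>R\<^sup>2\<close>.\<close>

lemma descent_preserves_radius: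
  fixes d d' R s \<alpha> :: real
  assumes "d'\<^sup>2 \<le> d\<^sup>2 - \<alpha> * s * d + \<alpha>\<^sup>2" "0 \<le> d" "d \<le> R" "0 < \<alpha>" "\<alpha> \<le> R" "\<alpha> \<le> s * R"
  shows "d' \<le> R"
proof -
  have "R > 0" using assms by linarith
  define l where "l = d / R"
  have l: "0 \<le> l" "l \<le> 1" "d = l * R" using assms \<open>R > 0\<close> by (auto simp: l_def)
  have "d\<^sup>2 \<le> l * R\<^sup>2"
    using mult_left_mono[OF assms(3,2)] l(3) by (simp add: power2_eq_square mult.assoc)
  moreover have "l * \<alpha>\<^sup>2 \<le> l * (\<alpha> * (s * R))"
    using l assms unfolding power2_eq_square by (intro mult_left_mono) auto
  moreover have "(1 - l) * \<alpha>\<^sup>2 \<le> (1 - l) * R\<^sup>2"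
    using l assms by (intro mult_left_mono power_mono) auto
  moreover have "\<alpha> * s * d = l * (\<alpha> * (s * R))" using l(3) by simp
  ultimately have "d\<^sup>2 - \<alpha> * s * d + \<alpha>\<^sup>2 \<le> R\<^sup>2"
    unfolding left_diff_distrib by linarith
  then have "d'\<^sup>2 \<le> R\<^sup>2" using assms(1) by linarith
  then show ?thesis by (rule power2_le_imp_le) (use \<open>R > 0\<close> in simp)
qed

section \<open>Descent of the distance in one iteration\<close>

text \<open>The growth bound controls an infimum over nearest solutions, whose attainment is not
  shown. Hence \<open>y\<close> is only nearly optimal for it and may depend on \<open>e\<close>,
  although its distance to \<open>z\<close> is exact.\<close>

lemma sharp_growth_subgradient:
  fixes f h :: "'a::euclidean_space \<Rightarrow> ereal"
  assumes h: "proper_fun h" "cont_diff_on (interior (eff_dom h)) h"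
    and X: "X \<subseteq> interior (eff_dom h)"
    and conv: "ereal_convex_on (interior (eff_dom h)) (\<lambda>z. f z + ereal \<rho> * h z)"
    and pos: "\<rho> > 0" "G > 0" "\<mu> > 0" "\<nu> > 0" "0 < \<beta>" "\<beta> < 1"
    and sharp: "sharp f X \<mu>" and growth: "local_bregman_growth h f X \<mu> \<rho> G \<nu>"
    and b: "opt_val f X = ereal b" and a: "f z = ereal a"
    and z: "z \<in> X" "infdist z (opt_set f X) \<le> (\<beta> * \<mu> / (\<rho> * G)) powr (1 / \<nu>)"
    and \<zeta>: "\<zeta> \<in> frechet_subdiff f z" and "e > 0"
  obtains y where "y \<in> opt_set f X" "dist z y = infdist z (opt_set f X)"
    "(1 - \<beta>) * (a - b) \<le> \<zeta> \<bullet> (z - y) + e"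
proof -
  let ?S = "opt_set f X" and ?R = "(\<beta> * \<mu> / (\<rho> * G)) powr (1 / \<nu>)"
  define d where "d = infdist z ?S"
  have d: "0 \<le> d" "d \<le> ?R" using z by (auto simp: d_def infdist_nonneg)
  have "?R < (\<mu> / (\<rho> * G)) powr (1 / \<nu>)"
    using pos by (intro powr_less_mono2 divide_strict_right_mono) auto
  \<comment> \<open>Because \<open>\<beta> < 1\<close>, even the boundary of the closed tube lies
    strictly inside the region where growth is available.\<close>
  then have "(INF y\<in>proj_set ?S z. bregman h y z) \<le> ereal (G * d powr (1 + \<nu>))"
    using growth z d(2) unfolding local_bregman_growth_def d_def by force
  \<comment> \<open>The Bregman term is later multiplied by \<open>\<rho>\<close>, which turns this
    slack into \<open>e\<close>.\<close>
  also have "\<dots> < ereal (G * d powr (1 + \<nu>) + e / \<rho>)"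
    using \<open>e > 0\<close> pos by simp
  finally obtain y where y: "y \<in> proj_set ?S z"
    and breg: "bregman h y z < ereal (G * d powr (1 + \<nu>) + e / \<rho>)"
    unfolding INF_less_iff by blast
  have yS: "y \<in> ?S" and ymin: "\<And>w. w \<in> ?S \<Longrightarrow> dist z y \<le> dist z w"
    using y by (auto simp: proj_set_def is_arg_min_linorder dist_norm norm_minus_commute)
  then have "?S \<noteq> {}" by blast
  have yd: "dist z y = d"
    unfolding d_def
  proof (rule antisym)
    show "dist z y \<le> infdist z ?S"
      unfolding infdist_notempty[OF \<open>?S \<noteq> {}\<close>]
      using \<open>?S \<noteq> {}\<close> ymin by (rule cINF_greatest)
  qed (rule infdist_le[OF yS])
  have "y \<in> X" and fy: "f y = ereal b" using yS b by (auto simp: opt_set_def)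
  have fin: "\<bar>h w\<bar> \<noteq> \<infinity>" if "w \<in> X" for w
    using that X h(1) interior_subset[of "eff_dom h"] by (auto simp: eff_dom_def proper_fun_def)
  obtain p q where hz: "h z = ereal p" and hy: "h y = ereal q"
    using fin[OF z(1)] fin[OF \<open>y \<in> X\<close>] by auto
  obtain g where g: "GDERIV (\<lambda>y. real_of_ereal (h y)) z :> g"
    using h(2) z(1) X unfolding cont_diff_on_def by blast
  have "q - p - g \<bullet> (y - z) \<le> G * d powr (1 + \<nu>) + e / \<rho>"
    using breg gderiv_grad[OF g] by (simp add: bregman_def hz hy)
  then have "\<rho> * (q - p - g \<bullet> (y - z)) \<le> \<rho> * (G * d powr (1 + \<nu>) + e / \<rho>)"
    using pos by (intro mult_left_mono) auto
  also have "\<dots> = \<rho> * G * d powr (1 + \<nu>) + e"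
    using pos by (simp add: distrib_left)
  \<comment> \<open>The radius satisfies
    \<open>\<rho> * G * ?R powr \<nu> = \<beta> * \<mu>\<close>, so inside the tube the power
    \<open>1 + \<nu>\<close> is dominated by a linear term that sharpness can compare with the
    gap.\<close>
  also have "\<rho> * G * d powr (1 + \<nu>) \<le> \<beta> * (\<mu> * d)"
  proof (cases "d = 0")
    case False
    have "d powr \<nu> \<le> ?R powr \<nu>" using d pos by (intro powr_mono2) auto
    also have "\<dots> = \<beta> * \<mu> / (\<rho> * G)" using pos by (simp add: powr_powr)
    finally have "\<rho> * G * d powr \<nu> \<le> \<beta> * \<mu>" using pos by (simp add: field_simps)
    then have "d * (\<rho> * G * d powr \<nu>) \<le> d * (\<beta> * \<mu>)"
      using d(1) by (intro mult_left_mono) auto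
    then show ?thesis using False d(1) by (simp add: powr_add mult_ac)
  qed simp
  also have "\<beta> * (\<mu> * d) \<le> \<beta> * (a - b)"
    using sharp z(1) pos a b unfolding sharp_def d_def by (intro mult_left_mono) auto
  finally have "\<rho> * (q - p - g \<bullet> (y - z)) \<le> \<beta> * (a - b) + e" by simp
  moreover have "a + \<zeta> \<bullet> (y - z) \<le> b + \<rho> * (q - p - g \<bullet> (y - z))"
  proof (rule relative_weak_convexity_subgradient[OF conv pos(1) _ _ \<zeta> _ fy hy a hz])
    show "g \<in> frechet_subdiff h z"
      using grad_in_frechet_subdiff[OF h(1) _ g] z(1) X by blast
  qed (use z(1) \<open>y \<in> X\<close> X in auto)
  ultimately have "(1 - \<beta>) * (a - b) \<le> \<zeta> \<bullet> (z - y) + e"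
    by (simp add: algebra_simps inner_diff_right)
  then show thesis using that yS yd by (simp add: d_def)
qed

lemma psga_descent:
  fixes f h :: "'a::euclidean_space \<Rightarrow> ereal"
  assumes h: "proper_fun h" "cont_diff_on (interior (eff_dom h)) h"
    and X: "X \<subseteq> interior (eff_dom h)" "closed X" "convex X"
    and conv: "ereal_convex_on (interior (eff_dom h)) (\<lambda>z. f z + ereal \<rho> * h z)"
    and pos: "\<rho> > 0" "G > 0" "\<mu> > 0" "\<nu> > 0" "0 < \<beta>" "\<beta> < 1"
    and sharp: "sharp f X \<mu>" and growth: "local_bregman_growth h f X \<mu> \<rho> G \<nu>"
    and b: "opt_val f X = ereal b" and a: "f z = ereal a"
    and z: "z \<in> X" "infdist z (opt_set f X) \<le> (\<beta> * \<mu> / (\<rho> * G)) powr (1 / \<nu>)"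
    and \<zeta>: "\<zeta> \<in> frechet_subdiff f z" "norm \<zeta> \<le> L" and "L > 0" "\<alpha> > 0"
    and p: "if \<zeta> = 0 then p = z else p \<in> proj_set X (z - (\<alpha> / norm \<zeta>) *\<^sub>R \<zeta>)"
  shows "(infdist p (opt_set f X))\<^sup>2
    \<le> (infdist z (opt_set f X))\<^sup>2 - 2 * (1 - \<beta>) / L * \<alpha> * (a - b) + \<alpha>\<^sup>2"
proof -
  let ?S = "opt_set f X"
  note sub = sharp_growth_subgradient[OF h X(1) conv pos sharp growth b a z \<zeta>(1)]
  define D where "D = (1 - \<beta>) * (a - b)"
  have rhs: "2 * (1 - \<beta>) / L * \<alpha> * (a - b) = 2 * \<alpha> * (D / L)" by (simp add: D_def)
  show ?thesis
  proof (cases "\<zeta> = 0")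
    \<comment> \<open>A zero subgradient forces \<open>D \<le> 0\<close>, so the claimed decrease is
      nonpositive and staying at \<open>z\<close> satisfies the recursion.\<close>
    case True
    have "D \<le> 0"
    proof (rule field_le_epsilon)
      fix e :: real assume "e > 0"
      show "D \<le> 0 + e" by (rule sub[OF \<open>e > 0\<close>]) (simp add: D_def True)
    qed
    then have "2 * \<alpha> * (D / L) \<le> 0"
      using \<open>L > 0\<close> \<open>\<alpha> > 0\<close> by (simp add: mult_nonneg_nonpos divide_nonpos_pos)
    moreover have "p = z" using p True by simp
    ultimately show ?thesis
      unfolding rhs \<open>p = z\<close> using zero_le_power2[of \<alpha>] by linarith
  next
    case False
    have "ereal (\<mu> * infdist z ?S) \<le> ereal (a - b)" using sharp z(1) a b by (auto simp: sharp_def)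
    moreover have "0 \<le> \<mu> * infdist z ?S" using pos by (simp add: infdist_nonneg)
    ultimately have "0 \<le> a - b" by simp
    then have "D \<ge> 0" using pos by (simp add: D_def)
    show ?thesis unfolding rhs
    proof (rule field_le_epsilon)
      fix e :: real assume "e > 0"
      \<comment> \<open>Scaled so that multiplication by \<open>2 * \<alpha> / norm \<zeta>\<close>
        returns exactly \<open>e\<close>.\<close>
      define e' where "e' = e * norm \<zeta> / (2 * \<alpha>)"
      have "e' > 0" using \<open>e > 0\<close> \<open>\<alpha> > 0\<close> False by (simp add: e'_def)
      then obtain y where y: "y \<in> ?S" "dist z y = infdist z ?S" "D \<le> \<zeta> \<bullet> (z - y) + e'"
        using sub unfolding D_def by blast
      \<comment> \<open>The sign of \<open>D\<close>, obtained from sharpness, is what permits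
        replacing \<open>norm \<zeta>\<close> by the larger \<open>L\<close>.\<close>
      have "D / L - e' / norm \<zeta> \<le> D / norm \<zeta> - e' / norm \<zeta>"
        using \<open>D \<ge> 0\<close> \<open>L > 0\<close> \<zeta>(2) False
        by (intro diff_right_mono divide_left_mono mult_pos_pos) auto
      also have "\<dots> \<le> \<zeta> \<bullet> (z - y) / norm \<zeta>"
        unfolding diff_divide_distrib[symmetric] using y(3) by (intro divide_right_mono) auto
      finally have "2 * \<alpha> * (D / L - e' / norm \<zeta>) \<le> 2 * \<alpha> * (\<zeta> \<bullet> (z - y) / norm \<zeta>)"
        using \<open>\<alpha> > 0\<close> by (intro mult_left_mono) auto
      moreover have "2 * \<alpha> * (D / L - e' / norm \<zeta>) = 2 * \<alpha> * (D / L) - e"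
        using \<open>\<alpha> > 0\<close> False by (simp add: e'_def right_diff_distrib)
      moreover have "(infdist p ?S)\<^sup>2 \<le> (dist p y)\<^sup>2"
        using infdist_le[OF y(1)] infdist_nonneg by (intro power_mono) auto
      moreover have "(dist p y)\<^sup>2 \<le> (dist z y)\<^sup>2 - 2 * \<alpha> * (\<zeta> \<bullet> (z - y)) / norm \<zeta> + \<alpha>\<^sup>2"
        using y(1) p False X by (intro psga_step_dist) (auto simp: opt_set_def)
      ultimately show "(infdist p ?S)\<^sup>2 \<le> (infdist z ?S)\<^sup>2 - 2 * \<alpha> * (D / L) + \<alpha>\<^sup>2 + e"
        using y(2) by simp
    qed
  qed
qed

section \<open>Convergence of the algorithm\<close>

theorem theorem4p6:
  fixes h f :: "real ^ 'n \<Rightarrow> ereal"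
    and X :: "(real ^ 'n) set"
    and \<rho> \<mu> \<nu> G L \<tau> \<beta> :: real
    and \<alpha> :: "nat \<Rightarrow> real"
    and x \<zeta> :: "nat \<Rightarrow> real ^ 'n"
  assumes kernel: "legendre_kernel h"
    and X: "X \<subseteq> interior (eff_dom h)" "X \<noteq> {}" "closed X" "convex X"
    and f_proper: "proper_fun f"
    and rho: "\<rho> > 0"
    and weakly_convex: "ereal_convex_on (interior (eff_dom h)) (\<lambda>z. f z + ereal \<rho> * h z)"
    and f_lipschitz: "finite_locally_lipschitz_around X f"
    and opt_val_bounded: "opt_val f X > -\<infinity>"
    and opt_set_nonempty: "opt_set f X \<noteq> {}"
    and sharpness: "\<mu> > 0" "sharp f X \<mu>"
    and growth: "0 < \<nu>" "\<nu> \<le> 1" "G > 0" "local_bregman_growth h f X \<mu> \<rho> G \<nu>"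
    and L: "ereal L = Sup {ereal (norm \<xi>) | \<xi> z. \<xi> \<in> frechet_subdiff f z \<and> z \<in> tube f X \<mu> \<rho> G \<nu> 1}"
           "0 < L"
    and tau: "\<tau> = \<mu> / L"
    and beta: "0 < \<beta>" "\<beta> < 1"
    and start: "x 0 \<in> tube f X \<mu> \<rho> G \<nu> \<beta>"
    and run: "psga_run f X \<alpha> x \<zeta>"
    and step_to_0: "\<alpha> \<longlonglongrightarrow> 0"
    and step_sum: "filterlim (\<lambda>n. \<Sum>k<n. \<alpha> k) at_top sequentially"
    and step_bounds: "\<And>k. 0 < \<alpha> k"
        "\<And>k. \<alpha> k \<le> min 1 (2 * (1 - \<beta>) * \<tau>) * (\<beta> * \<mu> / (\<rho> * G)) powr (1 / \<nu>)"
  shows "((\<lambda>k. Min ((\<lambda>i. f (x i)) ` {..k})) \<longlonglongrightarrow> opt_val f X \<and>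
          liminf (\<lambda>k. f (x k)) = opt_val f X) \<and>
         liminf (\<lambda>k. ereal (infdist (x k) (opt_set f X))) = 0 \<and>
         (bounded (range x) \<longrightarrow>
            (\<exists>r z. strict_mono (r :: nat \<Rightarrow> nat) \<and> z \<in> opt_set f X \<and> (x \<circ> r) \<longlonglongrightarrow> z))"
proof -
  let ?S = "opt_set f X"
  define R where "R = (\<beta> * \<mu> / (\<rho> * G)) powr (1 / \<nu>)"
  have R: "0 < R" "R < (\<mu> / (\<rho> * G)) powr (1 / \<nu>)"
    using growth(1,3) rho sharpness(1) beta unfolding R_def
    by (auto intro!: powr_less_mono2 divide_strict_right_mono)
  have step: "\<zeta> k \<in> frechet_subdiff f (x k)"
    "if \<zeta> k = 0 then x (Suc k) = x k
     else x (Suc k) \<in> proj_set X (x k - (\<alpha> k / norm (\<zeta> k)) *\<^sub>R \<zeta> k)" for k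
    using run unfolding psga_run_def by blast+
  have xX: "x k \<in> X" for k
  proof (induction k)
    case 0
    then show ?case using start by (simp add: tube_def)
  next
    case (Suc k)
    then show ?case
      using step(2)[of k] by (auto simp: proj_set_def is_arg_min_linorder split: if_splits)
  qed
  have fin: "\<bar>f z\<bar> \<noteq> \<infinity>" if "z \<in> X" for z
    using f_lipschitz that unfolding finite_locally_lipschitz_around_def by (meson centre_in_ball)
  define u where "u k = real_of_ereal (f (x k))" for k
  have u: "f (x k) = ereal (u k)" for k
    using fin[OF xX] by (simp add: u_def ereal_real)
  obtain b where b: "opt_val f X = ereal b"
    using opt_set_nonempty fin unfolding opt_set_def by (metis (mono_tags, lifting) ereal_real' empty_Collect_eq)
  define d where "d k = infdist (x k) ?S" for k
  have d0: "0 \<le> d k" for k by (simp add: d_def infdist_nonneg)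
  have sharp: "\<mu> * d k \<le> u k - b" for k
    using sharpness(2) xX[of k] by (auto simp: sharp_def d_def u b dest!: bspec[of _ _ "x k"])
  have descent: "(d (Suc k))\<^sup>2 \<le> (d k)\<^sup>2 - 2 * (1 - \<beta>) / L * \<alpha> k * (u k - b) + (\<alpha> k)\<^sup>2"
    if "d k \<le> R" for k
  proof -
    \<comment> \<open>The closed tube of radius \<open>R\<close> lies in the open tube with
      parameter 1, over which \<open>L\<close> is the supremum.\<close>
    have "x k \<in> tube f X \<mu> \<rho> G \<nu> 1"
      using xX that R(2) by (simp add: tube_def d_def)
    then have "ereal (norm (\<zeta> k)) \<le> ereal L"
      unfolding L(1) using step(1) by (intro Sup_upper) blast
    then have "norm (\<zeta> k) \<le> L" by simp
    then show ?thesis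
      unfolding d_def
      using kernel X weakly_convex rho growth sharpness beta b u xX that step L(2) step_bounds(1)
      by (intro psga_descent) (auto simp: legendre_kernel_def d_def R_def)
  qed
  have dR: "d k \<le> R" for k
  proof (induction k)
    case 0
    then show ?case using start by (simp add: tube_def d_def R_def)
  next
    case (Suc k)
    let ?s = "2 * (1 - \<beta>) * \<tau>"
    have "0 < 2 * (1 - \<beta>) / L * \<alpha> k" using beta L(2) step_bounds(1)[of k] by simp
    then have "2 * (1 - \<beta>) / L * \<alpha> k * (\<mu> * d k) \<le> 2 * (1 - \<beta>) / L * \<alpha> k * (u k - b)"
      using sharp[of k] by (intro mult_left_mono) auto
    \<comment> \<open>With the gap replaced by \<open>\<mu> * d k\<close>, the factor
      \<open>\<mu> / L\<close> appears, which is why \<open>\<tau>\<close> enters the step size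
      bound.\<close>
    moreover have "2 * (1 - \<beta>) / L * \<alpha> k * (\<mu> * d k) = \<alpha> k * ?s * d k"
      by (simp add: tau)
    ultimately have "(d (Suc k))\<^sup>2 \<le> (d k)\<^sup>2 - \<alpha> k * ?s * d k + (\<alpha> k)\<^sup>2"
      using descent[OF Suc] by linarith
    \<comment> \<open>The two entries of the minimum give the endpoint conditions at
      \<open>d = 0\<close> and \<open>d = R\<close> respectively.\<close>
    moreover have "\<alpha> k \<le> R" "\<alpha> k \<le> ?s * R"
    proof -
      have "\<alpha> k \<le> min 1 ?s * R" using step_bounds(2) by (simp add: R_def)
      also have "min 1 ?s * R = min R (?s * R)" using R(1) by (simp add: min_mult_distrib_right)
      finally show "\<alpha> k \<le> R" "\<alpha> k \<le> ?s * R" by simp_all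
    qed
    ultimately show ?case
      using Suc d0 step_bounds(1)
      by (intro descent_preserves_radius[of "d (Suc k)" "d k" "\<alpha> k" ?s R]) auto
  qed
  have freq: "\<exists>\<^sub>F k in sequentially. u k - b < e" if "e > 0" for e
  proof (rule frequently_small_of_descent)
    show "(d (Suc k))\<^sup>2 \<le> (d k)\<^sup>2 - 2 * (1 - \<beta>) / L * \<alpha> k * (u k - b) + (\<alpha> k)\<^sup>2" for k
      by (rule descent[OF dR])
  qed (use beta L(2) step_bounds(1) step_to_0 step_sum that in auto)
  have freq_u: "\<exists>\<^sub>F k in sequentially. u k < b + e" if "e > 0" for e
    using freq[OF that] by (rule frequently_elim1) simp
  have freq_d: "\<exists>\<^sub>F k in sequentially. d k < e" if "e > 0" for e
  proof -
    have "\<mu> * e > 0" using that sharpness(1) by simp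
    from freq[OF this] show ?thesis
    proof (rule frequently_elim1)
      fix k assume "u k - b < \<mu> * e"
      then have "\<mu> * d k < \<mu> * e" using sharp[of k] by linarith
      then show "d k < e" using sharpness(1) by simp
    qed
  qed
  have ub: "b \<le> u k" for k
    using sharp[of k] d0[of k] sharpness(1) by (smt (verit) mult_nonneg_nonneg)
  have Min_eq: "Min ((\<lambda>i. f (x i)) ` {..k}) = ereal (Min (u ` {..k}))" for k
    unfolding u image_image[of ereal u, symmetric]
    by (rule mono_Min_commute[symmetric]) (auto simp: mono_def)
  have "(\<lambda>k. Min ((\<lambda>i. f (x i)) ` {..k})) \<longlonglongrightarrow> opt_val f X"
    unfolding Min_eq b using running_Min_tendsto[OF ub freq_u] by simp
  moreover have "liminf (\<lambda>k. f (x k)) = opt_val f X"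
    unfolding u b by (rule liminf_ereal_eqI[OF ub freq_u])
  moreover have "liminf (\<lambda>k. ereal (infdist (x k) ?S)) = 0"
    using liminf_ereal_eqI[of 0 d] d0 freq_d by (simp add: d_def zero_ereal_def)
  moreover have "\<exists>r z. strict_mono (r :: nat \<Rightarrow> nat) \<and> z \<in> ?S \<and> (x \<circ> r) \<longlonglongrightarrow> z"
    if "bounded (range x)"
  proof -
    \<comment> \<open>An arbitrary convergent subsequence could stay away from the solutions, so
      indices with vanishing distance are selected first and compactness is applied to them.\<close>
    have "\<exists>k. d k < inverse (real (Suc n)) \<and> m < k" for n m
    proof -
      have "\<exists>\<^sub>F k in sequentially. d k < inverse (real (Suc n))" by (rule freq_d) simp
      then show ?thesis unfolding frequently_sequentially by (meson Suc_le_lessD)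
    qed
    then obtain s where s: "d (s n) < inverse (real (Suc n))" "s n < s (Suc n)" for n
      using dependent_nat_choice[of "\<lambda>n k. d k < inverse (real (Suc n))" "\<lambda>n k k'. k < k'"]
      by metis
    have "bounded (range (x \<circ> s))"
      by (rule bounded_subset[OF that]) auto
    then obtain z r where r: "strict_mono (r :: nat \<Rightarrow> nat)" "((x \<circ> s) \<circ> r) \<longlonglongrightarrow> z"
      using bounded_imp_convergent_subsequence by blast
    have "(\<lambda>n. d (s n)) \<longlonglongrightarrow> 0"
      using s(1) d0 by (intro tendsto_sandwich[OF _ _ tendsto_const LIMSEQ_inverse_real_of_nat])
        (auto intro!: always_eventually less_imp_le)
    then have "(\<lambda>n. d (s (r n))) \<longlonglongrightarrow> 0"
      using LIMSEQ_subseq_LIMSEQ[OF _ r(1)] by (auto simp: o_def)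
    moreover have "(\<lambda>n. d (s (r n))) \<longlonglongrightarrow> infdist z ?S"
      using tendsto_infdist[OF r(2), of ?S] by (simp add: d_def o_def)
    ultimately have "infdist z ?S = 0" using LIMSEQ_unique by blast
    then have "z \<in> ?S"
      using in_closed_iff_infdist_zero[OF opt_set_closed[OF X(3) f_lipschitz] opt_set_nonempty]
      by simp
    moreover have "strict_mono (s \<circ> r)"
      using s(2) r(1) by (intro strict_mono_o) (simp_all add: strict_mono_Suc_iff)
    ultimately show ?thesis using r(2) unfolding comp_assoc by blast
  qed
  ultimately show ?thesis by blast
qed

end
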